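(* Let $A$ be a Banach algebra. (1) Let $B$ be a left Banach $A$-module with action $\pi_\ell:A\times B\to B$, and let $b'\in B^*$. Then $b'\in wap_\ell(B)$ if and only if the adjoint $B^{**}\to A^*$ of the mapping $\pi_\ell^*(b',\cdot):A\to B^*$ is weak$^*$-to-weak continuous. (2) Let $B$ be a right Banach $A$-module with action $\pi_r:B\times A\to B$, and let $b'\in B^*$. Then $b'\in wap_r(B)$ if and only if the adjoint $A^{**}\to B^*$ of the mapping $\pi_r^*(b',\cdot):B\to A^*$ is weak$^*$-to-weak continuous.
   Context: For a bounded bilinear $m:X\times Y\to Z$ of normed spaces, $m^*:Z^*\times X\to Y^*$ is defined by $\langle m^*(z',x),y\rangle=\langle z',m(x,y)\rangle$. Thus $\langle\pi_\ell^*(b',a),b\rangle=\langle b',\pi_\ell(a,b)\rangle$ and $\langle\pi_r^*(b',b),a\rangle=\langle b',\pi_r(b,a)\rangle$. $wap_\ell(B)$ (left weakly almost periodic functionals) is the set of $b'\in B^*$ such that $\{\pi_\ell^*(b',a):a\in A,\|a\|\le1\}$ is relatively weakly compact in $B^*$; $wap_r(B)$ (right weakly almost periodic functionals) is the set of $b'\in B^*$ such that $\{\pi_r^*(b',b):b\in B,\|b\|\le1\}$ is relatively weakly compact in $A^*$. The adjoint of $\pi_\ell^*(b',\cdot):A\to B^*$ is taken as a map $B^{**}\to A^*$ (weak$^*$ topology on $B^{**}=(B^* )^*$, weak topology $\sigma(A^*,A^{**})$ on $A^*$); similarly for $\pi_r^*(b',\cdot)$, with $\sigma(B^*,B^{**})$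 on $B^*$. *)

theory Defs
  imports "HOL-Analysis.Analysis"
begin

(* The scalar field is a type 'k of sort {real_normed_field, euclidean_space}.  Both real and complex
   are instances and, up to isometric isomorphism, the only ones (a finite-dimensional commutative
   real division algebra with multiplicative norm), so real and complex scalars are treated at once.
   The type classes of the library only know real scalars; the 'k-structure of a normed space
   is therefore an explicit scalar multiplication extending *\<^sub>R. *)

section \<open>Normed spaces, Banach algebras and Banach modules over the scalar field\<close>

locale normed_space_over =
  vector_space sc for sc :: "'k::{real_normed_field, euclidean_space} \<Rightarrow> 'x::real_normed_vector \<Rightarrow> 'x" +
  assumes scale_of_real: "sc (of_real r) x = r *\<^sub>R x"
    and norm_scale: "norm (sc c x) = norm c * norm x"

(* Completeness is the sort constraint banach; no unit is required. *)
locale banach_algebra_over =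
  normed_space_over scaleA
  for scaleA :: "'k::{real_normed_field, euclidean_space} \<Rightarrow> 'a::{real_normed_algebra, banach} \<Rightarrow> 'a" +
  assumes scale_mult_left: "scaleA c x * y = scaleA c (x * y)"
    and scale_mult_right: "x * scaleA c y = scaleA c (x * y)"

(* bounded_bilinear is real bilinearity with norm (m x y) \<le> norm x * norm y * K. *)
locale bounded_bilinear_over =
  X: normed_space_over scaleX + Y: normed_space_over scaleY + Z: normed_space_over scaleZ +
  bounded_bilinear m
  for scaleX :: "'k::{real_normed_field, euclidean_space} \<Rightarrow> 'x::real_normed_vector \<Rightarrow> 'x"
    and scaleY :: "'k \<Rightarrow> 'y::real_normed_vector \<Rightarrow> 'y"
    and scaleZ :: "'k \<Rightarrow> 'z::real_normed_vector \<Rightarrow> 'z"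
    and m :: "'x \<Rightarrow> 'y \<Rightarrow> 'z" +
  assumes scale_left_over: "m (scaleX c x) y = scaleZ c (m x y)"
    and scale_right_over: "m x (scaleY c y) = scaleZ c (m x y)"

locale left_banach_module =
  banach_algebra_over scaleA + bounded_bilinear_over scaleA scaleB scaleB act
  for scaleA :: "'k::{real_normed_field, euclidean_space} \<Rightarrow> 'a::{real_normed_algebra, banach} \<Rightarrow> 'a"
    and scaleB :: "'k \<Rightarrow> 'b::banach \<Rightarrow> 'b"
    and act :: "'a \<Rightarrow> 'b \<Rightarrow> 'b" +
  assumes act_assoc: "act (a1 * a2) b = act a1 (act a2 b)"

locale right_banach_module =
  banach_algebra_over scaleA + bounded_bilinear_over scaleB scaleA scaleB act
  for scaleA :: "'k::{real_normed_field, euclidean_space} \<Rightarrow> 'a::{real_normed_algebra, banach} \<Rightarrow> 'a"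
    and scaleB :: "'k \<Rightarrow> 'b::banach \<Rightarrow> 'b"
    and act :: "'b \<Rightarrow> 'a \<Rightarrow> 'b" +
  assumes act_assoc: "act b (a1 * a2) = act (act b a1) a2"

section \<open>Dual and bidual\<close>

definition dual :: "('k::{real_normed_field, euclidean_space} \<Rightarrow> 'x::real_normed_vector \<Rightarrow> 'x)
    \<Rightarrow> ('x \<Rightarrow>\<^sub>L 'k) set"
  where "dual sc = {f. \<forall>c x. blinfun_apply f (sc c x) = c * blinfun_apply f x}"

definition scale_fun :: "'k::real_normed_field \<Rightarrow> ('x::real_normed_vector \<Rightarrow>\<^sub>L 'k) \<Rightarrow> ('x \<Rightarrow>\<^sub>L 'k)"
  where "scale_fun c f = Blinfun (\<lambda>x. c * blinfun_apply f x)"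

(* The dual is only a subspace of the type of bounded real-linear maps, so its bounded functionals
   are functions on that set, with the junk value undefined outside it. *)
definition bidual :: "('k::{real_normed_field, euclidean_space} \<Rightarrow> 'x::real_normed_vector \<Rightarrow> 'x)
    \<Rightarrow> (('x \<Rightarrow>\<^sub>L 'k) \<Rightarrow> 'k) set"
  where "bidual sc = {F \<in> extensional (dual sc).
     (\<forall>f\<in>dual sc. \<forall>g\<in>dual sc. F (f + g) = F f + F g) \<and>
     (\<forall>c. \<forall>f\<in>dual sc. F (scale_fun c f) = c * F f) \<and>
     (\<exists>C. \<forall>f\<in>dual sc. norm (F f) \<le> C * norm f)}"

section \<open>Weak and weak* topologies\<close>

(* Coarsest topology on S for which all members of \<Phi> are continuous; the generator S is
   there to make S the underlying set. *)
definition initial_topology :: "'s set \<Rightarrow> ('s \<Rightarrow> 'k::topological_space) set \<Rightarrow> 's topology"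
  where "initial_topology S \<Phi> =
    topology_generated_by (insert S {{s \<in> S. \<phi> s \<in> U} | \<phi> U. \<phi> \<in> \<Phi> \<and> open U})"

(* \<sigma>(X*, X** ) *)
definition weak_topology_dual :: "('k::{real_normed_field, euclidean_space} \<Rightarrow> 'x::real_normed_vector \<Rightarrow> 'x)
    \<Rightarrow> ('x \<Rightarrow>\<^sub>L 'k) topology"
  where "weak_topology_dual sc = initial_topology (dual sc) (bidual sc)"

(* \<sigma>(X**, X* ) *)
definition weak_star_topology_bidual :: "('k::{real_normed_field, euclidean_space} \<Rightarrow> 'x::real_normed_vector \<Rightarrow> 'x)
    \<Rightarrow> (('x \<Rightarrow>\<^sub>L 'k) \<Rightarrow> 'k) topology"
  where "weak_star_topology_bidual sc =
    initial_topology (bidual sc) ((\<lambda>f F. F f) ` dual sc)"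

definition relatively_compactin :: "'s topology \<Rightarrow> 's set \<Rightarrow> bool"
  where "relatively_compactin T S \<longleftrightarrow> S \<subseteq> topspace T \<and> compactin T (T closure_of S)"

section \<open>Adjoints and weakly almost periodic functionals\<close>

definition bilinear_adjoint :: "('x::real_normed_vector \<Rightarrow> 'y::real_normed_vector \<Rightarrow> 'z::real_normed_vector)
    \<Rightarrow> ('z \<Rightarrow>\<^sub>L 'k::real_normed_field) \<Rightarrow> 'x \<Rightarrow> ('y \<Rightarrow>\<^sub>L 'k)"
  where "bilinear_adjoint m z' x = Blinfun (\<lambda>y. blinfun_apply z' (m x y))"

(* The adjoint X** \<rightarrow> Y* of an operator T from Y to X*. *)
definition adjoint_op :: "('y::real_normed_vector \<Rightarrow> ('x::real_normed_vector \<Rightarrow>\<^sub>L 'k::real_normed_field))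
    \<Rightarrow> (('x \<Rightarrow>\<^sub>L 'k) \<Rightarrow> 'k) \<Rightarrow> ('y \<Rightarrow>\<^sub>L 'k)"
  where "adjoint_op T F = Blinfun (\<lambda>y. F (T y))"

definition wap_left :: "('k::{real_normed_field, euclidean_space} \<Rightarrow> 'b::real_normed_vector \<Rightarrow> 'b)
    \<Rightarrow> ('a::real_normed_vector \<Rightarrow> 'b \<Rightarrow> 'b) \<Rightarrow> ('b \<Rightarrow>\<^sub>L 'k) set"
  where "wap_left scaleB act = {b' \<in> dual scaleB.
    relatively_compactin (weak_topology_dual scaleB) {bilinear_adjoint act b' a | a. norm a \<le> 1}}"

definition wap_right :: "('k::{real_normed_field, euclidean_space} \<Rightarrow> 'a::real_normed_vector \<Rightarrow> 'a)
    \<Rightarrow> ('k \<Rightarrow> 'b::real_normed_vector \<Rightarrow> 'b) \<Rightarrow> ('b \<Rightarrow> 'a \<Rightarrow> 'b) \<Rightarrow> ('b \<Rightarrow>\<^sub>L 'k) set"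
  where "wap_right scaleA scaleB act = {b' \<in> dual scaleB.
    relatively_compactin (weak_topology_dual scaleA) {bilinear_adjoint act b' b | b. norm b \<le> 1}}"

section \<open>Basic facts\<close>

lemma normed_space_over_real: "normed_space_over ((*\<^sub>R) :: real \<Rightarrow> 'x::real_normed_vector \<Rightarrow> 'x)"
  by unfold_locales (auto simp: algebra_simps)

lemma normed_space_over_complex: "normed_space_over ((*) :: complex \<Rightarrow> complex \<Rightarrow> complex)"
  by unfold_locales (auto simp: algebra_simps norm_mult scaleR_conv_of_real)

lemma topspace_initial_topology [simp]: "topspace (initial_topology S \<Phi>) = S"
  unfolding initial_topology_def topology_generated_by_topspace by auto

lemma continuous_map_initial_topology:
  assumes "\<phi> \<in> \<Phi>"
  shows "continuous_map (initial_topology S \<Phi>) euclidean \<phi>"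
  using assms unfolding initial_topology_def
  by (fastforce simp: continuous_map_def topology_generated_by_topspace openin_topology_generated_by_iff
      intro: generate_topology_on.Basis)

lemma scale_fun_apply [simp]: "blinfun_apply (scale_fun c f) x = c * blinfun_apply f x"
  unfolding scale_fun_def
  by (subst bounded_linear_Blinfun_apply)
    (auto intro: bounded_linear_const_mult blinfun.bounded_linear_right)

lemma add_in_dual: "f \<in> dual s \<Longrightarrow> g \<in> dual s \<Longrightarrow> f + g \<in> dual s"
  by (auto simp: dual_def blinfun.add_left algebra_simps)

lemma scale_fun_in_dual: "f \<in> dual s \<Longrightarrow> scale_fun c f \<in> dual s"
  by (auto simp: dual_def)

lemma scaleR_eq_scale_fun: "r *\<^sub>R f = scale_fun (of_real r) f"
  by (rule blinfun_eqI) (simp add: blinfun.scaleR_left scaleR_conv_of_real)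

context bounded_bilinear_over
begin

lemma bilinear_adjoint_apply:
  "blinfun_apply (bilinear_adjoint m z' x) y = blinfun_apply z' (m x y)"
  unfolding bilinear_adjoint_def
  by (subst bounded_linear_Blinfun_apply)
    (auto intro: bounded_linear_compose[OF blinfun.bounded_linear_right bounded_linear_right])

lemma bilinear_adjoint_in_dual: "z' \<in> dual scaleZ \<Longrightarrow> bilinear_adjoint m z' x \<in> dual scaleY"
  by (auto simp: dual_def bilinear_adjoint_apply scale_right_over)

lemma adjoint_op_bilinear_adjoint_apply:
  assumes z': "z' \<in> dual scaleZ" and F: "F \<in> bidual scaleY"
  shows "blinfun_apply (adjoint_op (bilinear_adjoint m z') F) x = F (bilinear_adjoint m z' x)"
proof -
  have D: "bilinear_adjoint m z' x \<in> dual scaleY" for x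
    by (rule bilinear_adjoint_in_dual[OF z'])
  obtain C where C: "\<And>f. f \<in> dual scaleY \<Longrightarrow> norm (F f) \<le> C * norm f"
    using F unfolding bidual_def by blast
  obtain K where K: "K > 0" "\<And>x y. norm (m x y) \<le> norm x * norm y * K"
    using pos_bounded by blast
  have "bounded_linear (\<lambda>x. F (bilinear_adjoint m z' x))"
  proof (rule bounded_linear_intro)
    fix x1 x2
    have "bilinear_adjoint m z' (x1 + x2) = bilinear_adjoint m z' x1 + bilinear_adjoint m z' x2"
      by (rule blinfun_eqI)
        (simp add: bilinear_adjoint_apply add_left blinfun.add_right blinfun.add_left)
    then show "F (bilinear_adjoint m z' (x1 + x2)) =
        F (bilinear_adjoint m z' x1) + F (bilinear_adjoint m z' x2)"
      using F D by (auto simp: bidual_def)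
  next
    fix r x
    have "bilinear_adjoint m z' (r *\<^sub>R x) = scale_fun (of_real r) (bilinear_adjoint m z' x)"
      by (rule blinfun_eqI)
        (simp add: bilinear_adjoint_apply scaleR_left blinfun.scaleR_right scaleR_conv_of_real)
    then show "F (bilinear_adjoint m z' (r *\<^sub>R x)) = r *\<^sub>R F (bilinear_adjoint m z' x)"
      using F D by (auto simp: bidual_def scaleR_conv_of_real)
  next
    fix x
    have *: "norm (bilinear_adjoint m z' x) \<le> norm z' * K * norm x"
    proof (rule norm_blinfun_bound)
      show "0 \<le> norm z' * K * norm x" using K by simp
      fix y
      have "norm (blinfun_apply z' (m x y)) \<le> norm z' * norm (m x y)"
        by (rule norm_blinfun)
      also have "\<dots> \<le> norm z' * (norm x * norm y * K)"
        by (intro mult_left_mono K) simp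
      finally show "norm (blinfun_apply (bilinear_adjoint m z' x) y) \<le> norm z' * K * norm x * norm y"
        by (simp add: bilinear_adjoint_apply mult_ac)
    qed
    have "norm (F (bilinear_adjoint m z' x)) \<le> C * norm (bilinear_adjoint m z' x)"
      by (rule C[OF D])
    also have "\<dots> \<le> \<bar>C\<bar> * (norm z' * K * norm x)"
      using * by (intro mult_mono) auto
    finally show "norm (F (bilinear_adjoint m z' x)) \<le> norm x * (\<bar>C\<bar> * norm z' * K)"
      by (simp add: mult_ac)
  qed
  then show ?thesis
    unfolding adjoint_op_def by (simp add: bounded_linear_Blinfun_apply)
qed

lemma adjoint_op_in_dual:
  assumes z': "z' \<in> dual scaleZ" and F: "F \<in> bidual scaleY"
  shows "adjoint_op (bilinear_adjoint m z') F \<in> dual scaleX"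
proof -
  have "bilinear_adjoint m z' (scaleX c x) = scale_fun c (bilinear_adjoint m z' x)" for c x
    using z' by (intro blinfun_eqI) (simp add: bilinear_adjoint_apply scale_left_over dual_def)
  then show ?thesis
    using F bilinear_adjoint_in_dual[OF z']
    by (simp add: dual_def[of scaleX] adjoint_op_bilinear_adjoint_apply[OF z' F]) (auto simp: bidual_def)
qed

end

end

(* For an operator T from X to Y*, let T* be its adjoint from Y** to X*.
   If T maps the unit ball onto a relatively weakly compact set and Phi is in X**, then Helly's
   lemma approximates Phi on finitely many functionals T* F by points of a ball of X, and weak
   compactness (finite intersection property) gives a single e in Y* with Phi (T* F) = F e for
   all F; hence Phi o T* is weak*-continuous.
   Conversely, if T* is weak*-to-weak continuous, each Phi o T* is a weak*-continuous functional,
   hence evaluation at some R Phi in Y*. The map R is weak*-to-weak continuous and extends T, so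
   by the Banach-Alaoglu theorem the image of the unit ball of X** under R is a weakly compact,
   hence closed, set containing the image of the unit ball of X under T. *)

theory Submission
  imports Defs
begin

section \<open>Initial topologies\<close>

text \<open>Basic neighbourhoods, by induction on the generation of open sets: an intersection joins
  the two finite families and takes the smaller radius, and the generator \<open>S\<close> needs no
  functional at all.\<close>

lemma openin_initial_topologyD:
  fixes \<Phi> :: "('s \<Rightarrow> 'k::metric_space) set"
  assumes "openin (initial_topology S \<Phi>) U" "s \<in> U"
  shows "\<exists>\<Psi> e. finite \<Psi> \<and> \<Psi> \<subseteq> \<Phi> \<and> e > 0 \<and>
    {t \<in> S. \<forall>\<psi>\<in>\<Psi>. dist (\<psi> t) (\<psi> s) < e} \<subseteq> U"
proof -
  have "generate_topology_on (insert S {{s \<in> S. \<phi> s \<in> U} | \<phi> U. \<phi> \<in> \<Phi> \<and> open U}) U"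
    using assms by (simp add: initial_topology_def openin_topology_generated_by_iff)
  then show ?thesis
    using assms(2)
  proof (induction rule: generate_topology_on.induct)
    case Empty
    then show ?case by simp
  next
    case (Int a b)
    then obtain \<Psi>1 e1 \<Psi>2 e2 where
      "finite \<Psi>1" "\<Psi>1 \<subseteq> \<Phi>" "e1 > 0" "{t \<in> S. \<forall>\<psi>\<in>\<Psi>1. dist (\<psi> t) (\<psi> s) < e1} \<subseteq> a"
      "finite \<Psi>2" "\<Psi>2 \<subseteq> \<Phi>" "e2 > 0" "{t \<in> S. \<forall>\<psi>\<in>\<Psi>2. dist (\<psi> t) (\<psi> s) < e2} \<subseteq> b"
      by (meson IntD1 IntD2)
    then show ?case
      by (intro exI[of _ "\<Psi>1 \<union> \<Psi>2"] exI[of _ "min e1 e2"]) auto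
  next
    case (UN K)
    then obtain k where "k \<in> K" "s \<in> k" by blast
    with UN.IH show ?case by (meson Union_upper subset_trans)
  next
    case (Basis b)
    then consider "b = S" | \<phi> V where "b = {s \<in> S. \<phi> s \<in> V}" "\<phi> \<in> \<Phi>" "open V" by blast
    then show ?case
    proof cases
      case 1
      then show ?thesis by (intro exI[of _ "{}"] exI[of _ 1]) auto
    next
      case 2
      with Basis.prems obtain e where "e > 0" "\<And>z. dist z (\<phi> s) < e \<Longrightarrow> z \<in> V"
        by (auto simp: open_dist)
      with 2 show ?thesis by (intro exI[of _ "{\<phi>}"] exI[of _ e]) auto
    qed
  qed
qed

text \<open>Universal property: preimages of generators suffice, so continuity into a weak topology
  is tested on one functional at a time.\<close>

lemma continuous_map_into_initial_topology:
  assumes "f \<in> topspace T \<rightarrow> S" "\<And>\<phi>. \<phi> \<in> \<Phi> \<Longrightarrow> continuous_map T euclidean (\<lambda>x. \<phi> (f x))"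
  shows "continuous_map T (initial_topology S \<Phi>) f"
  unfolding initial_topology_def
proof (rule continuous_on_generated_topo)
  fix U assume "U \<in> insert S {{s \<in> S. \<phi> s \<in> U} | \<phi> U. \<phi> \<in> \<Phi> \<and> open U}"
  then consider "U = S" | \<phi> V where "U = {s \<in> S. \<phi> s \<in> V}" "\<phi> \<in> \<Phi>" "open V" by blast
  then show "openin T (f -` U \<inter> topspace T)"
  proof cases
    case 1
    then have "f -` U \<inter> topspace T = topspace T" using assms(1) by auto
    then show ?thesis by simp
  next
    case 2
    then have "f -` U \<inter> topspace T = {x \<in> topspace T. \<phi> (f x) \<in> V}" using assms(1) by auto
    then show ?thesis using openin_continuous_map_preimage[OF assms(2)[OF 2(2)]] 2(3) by simp
  qed
qed (use assms(1) in \<open>simp add: image_subset_iff Pi_iff\<close>)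

text \<open>A functional separating two points pulls back disjoint open sets of scalars. The purpose
  is to make compact sets closed.\<close>

lemma Hausdorff_initial_topology:
  fixes \<Phi> :: "('s \<Rightarrow> 'k::t2_space) set"
  assumes "\<And>s t. s \<in> S \<Longrightarrow> t \<in> S \<Longrightarrow> (\<And>\<phi>. \<phi> \<in> \<Phi> \<Longrightarrow> \<phi> s = \<phi> t) \<Longrightarrow> s = t"
  shows "Hausdorff_space (initial_topology S \<Phi>)"
  unfolding Hausdorff_space_def
proof (intro allI impI)
  fix s t
  assume "s \<in> topspace (initial_topology S \<Phi>) \<and> t \<in> topspace (initial_topology S \<Phi>) \<and> s \<noteq> t"
  then have st: "s \<in> S" "t \<in> S" "s \<noteq> t" by auto
  have "\<exists>\<phi>\<in>\<Phi>. \<phi> s \<noteq> \<phi> t"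
  proof (rule ccontr)
    assume "\<not> ?thesis"
    then have "\<phi> s = \<phi> t" if "\<phi> \<in> \<Phi>" for \<phi> using that by simp
    from assms[OF st(1,2) this] st(3) show False by simp
  qed
  then obtain \<phi> where \<phi>: "\<phi> \<in> \<Phi>" "\<phi> s \<noteq> \<phi> t" by blast
  then obtain U V where UV: "open U" "open V" "\<phi> s \<in> U" "\<phi> t \<in> V" "U \<inter> V = {}"
    using hausdorff[OF \<phi>(2)] by blast
  have "openin (initial_topology S \<Phi>) {x \<in> S. \<phi> x \<in> W}" if "open W" for W
    using openin_continuous_map_preimage[OF continuous_map_initial_topology[OF \<phi>(1), of S], of W] that
    by simp
  then show "\<exists>U V. openin (initial_topology S \<Phi>) U \<and> openin (initial_topology S \<Phi>) V \<and>
      s \<in> U \<and> t \<in> V \<and> disjnt U V"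
    using UV st by (intro exI[of _ "{x \<in> S. \<phi> x \<in> U}"] exI[of _ "{x \<in> S. \<phi> x \<in> V}"])
      (auto simp: disjnt_def)
qed

section \<open>Linear structure of the dual and bidual\<close>

lemma zero_in_dual [simp]: "0 \<in> dual sc"
  by (simp add: dual_def)

lemma sum_scale_in_dual: "(\<And>i. i \<in> I \<Longrightarrow> f i \<in> dual sc) \<Longrightarrow> (\<Sum>i\<in>I. scale_fun (c i) (f i)) \<in> dual sc"
  by (induction I rule: infinite_finite_induct) (auto intro: add_in_dual scale_fun_in_dual)

lemma bidual_sum_scale:
  fixes sc :: "'a::{real_normed_field, euclidean_space} \<Rightarrow> 'b::real_normed_vector \<Rightarrow> 'b"
  assumes "F \<in> bidual sc" "\<And>i. i \<in> I \<Longrightarrow> f i \<in> dual sc"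
  shows "F (\<Sum>i\<in>I. scale_fun (c i) (f i)) = (\<Sum>i\<in>I. c i * F (f i))"
proof -
  have "F (scale_fun 0 0) = 0 * F 0"
    using assms(1) by (auto simp: bidual_def)
  moreover have "scale_fun 0 0 = (0 :: 'b \<Rightarrow>\<^sub>L 'a)"
    by (rule blinfun_eqI) simp
  ultimately have F0: "F 0 = 0" by simp
  show ?thesis
    using assms(2)
  proof (induction I rule: infinite_finite_induct)
    case (insert i I)
    have "F (scale_fun (c i) (f i) + (\<Sum>i\<in>I. scale_fun (c i) (f i))) =
        F (scale_fun (c i) (f i)) + F (\<Sum>i\<in>I. scale_fun (c i) (f i))"
      using assms(1) insert.prems sum_scale_in_dual[of I f sc c]
        scale_fun_in_dual[of "f i" sc "c i"] by (simp add: bidual_def)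
    also have "F (scale_fun (c i) (f i)) = c i * F (f i)"
      using assms(1) insert.prems by (auto simp: bidual_def)
    finally show ?case using insert by simp
  qed (auto simp: F0)
qed

text \<open>The restriction restores the value \<open>undefined\<close> outside the dual, which a
  pointwise combination would lose. Sum and multiple are merged so that linearity of a functional on
  the bidual becomes a single equation.\<close>

lemma bidual_combination:
  assumes "F \<in> bidual sc" "G \<in> bidual sc"
  shows "(\<lambda>f\<in>dual sc. F f + c * G f) \<in> bidual sc"
proof -
  obtain C D where C: "\<And>f. f \<in> dual sc \<Longrightarrow> norm (F f) \<le> C * norm f"
    and D: "\<And>f. f \<in> dual sc \<Longrightarrow> norm (G f) \<le> D * norm f"
    using assms unfolding bidual_def by blast
  have "norm (F f + c * G f) \<le> (C + norm c * D) * norm f" if "f \<in> dual sc" for f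
  proof -
    have "norm (F f + c * G f) \<le> norm (F f) + norm c * norm (G f)"
      by (metis norm_mult norm_triangle_ineq)
    also have "\<dots> \<le> C * norm f + norm c * (D * norm f)"
      using C D that by (intro add_mono mult_left_mono) auto
    finally show ?thesis by (simp add: algebra_simps)
  qed
  then have "\<exists>C. \<forall>f\<in>dual sc. norm (F f + c * G f) \<le> C * norm f" by blast
  moreover have "F (f + g) + c * G (f + g) = F f + c * G f + (F g + c * G g)"
    if "f \<in> dual sc" "g \<in> dual sc" for f g
    using assms that by (simp add: bidual_def distrib_left)
  moreover have "F (scale_fun d f) + c * G (scale_fun d f) = d * (F f + c * G f)"
    if "f \<in> dual sc" for d f
    using assms that by (simp add: bidual_def algebra_simps)
  ultimately show ?thesis
    by (simp add: bidual_def add_in_dual scale_fun_in_dual)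
qed

text \<open>This is the canonical embedding of a space into its bidual.\<close>

lemma evaluation_in_bidual: "(\<lambda>f\<in>dual sc. blinfun_apply f x) \<in> bidual sc"
proof -
  have "norm (blinfun_apply f x) \<le> norm x * norm f" for f
    using norm_blinfun[of f x] by (simp add: mult.commute)
  then have "\<exists>C. \<forall>f\<in>dual sc. norm (blinfun_apply f x) \<le> C * norm f" by blast
  then show ?thesis
    by (simp add: bidual_def add_in_dual scale_fun_in_dual blinfun.add_left)
qed

lemma zero_in_bidual:
  fixes sc :: "'k::{real_normed_field, euclidean_space} \<Rightarrow> 'x::real_normed_vector \<Rightarrow> 'x"
  shows "(\<lambda>f\<in>dual sc. (0 :: 'k)) \<in> bidual sc"
  using evaluation_in_bidual[of 0 sc] by (simp add: blinfun.zero_right)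

lemma Hausdorff_weak_topology_dual: "Hausdorff_space (weak_topology_dual sc)"
  unfolding weak_topology_dual_def
proof (rule Hausdorff_initial_topology)
  fix f g assume *: "f \<in> dual sc" "g \<in> dual sc" "\<And>F. F \<in> bidual sc \<Longrightarrow> F f = F g"
  show "f = g"
  proof (rule blinfun_eqI)
    fix x
    have "(\<lambda>h\<in>dual sc. blinfun_apply h x) f = (\<lambda>h\<in>dual sc. blinfun_apply h x) g"
      by (rule *(3)) (rule evaluation_in_bidual)
    then show "blinfun_apply f x = blinfun_apply g x"
      unfolding restrict_apply'[OF *(1)] restrict_apply'[OF *(2)] .
  qed
qed

section \<open>Helly's lemma\<close>

text \<open>The inner product of the scalar field plays the role of the real part: every real-linear
  functional on the field has the form \<open>z \<mapsto> Re (\<kappa> z)\<close>, where \<open>Re u = inner 1 u\<close>.\<close>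
lemma inner_eq_inner_one:
  fixes v z :: "'k::{real_normed_field, euclidean_space}"
  shows "inner v z = inner 1 ((norm v)\<^sup>2 *\<^sub>R (inverse v * z))"
proof (cases "v = 0")
  case False
  have *: "(norm (inverse v * u))\<^sup>2 = (norm u)\<^sup>2 / (norm v)\<^sup>2" for u
    unfolding norm_mult norm_inverse power_mult_distrib power_inverse divide_inverse
    by (rule mult.commute)
  \<comment> \<open>Polarisation expresses the inner product through norms; multiplicativity of the
    norm then extracts the factor \<open>1 / (norm v)\<^sup>2\<close>.\<close>
  have "2 * inner 1 (inverse v * z) = (norm (1 + inverse v * z))\<^sup>2 - 1 - (norm (inverse v * z))\<^sup>2"
    unfolding power2_norm_eq_inner using norm_eq_1[of "1 :: 'k"]
    by (simp add: inner_add_left inner_add_right inner_commute)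
  also have "1 + inverse v * z = inverse v * (v + z)"
    using False by (simp add: distrib_left)
  also have "(norm (inverse v * (v + z)))\<^sup>2 - 1 - (norm (inverse v * z))\<^sup>2
      = ((norm (v + z))\<^sup>2 - (norm v)\<^sup>2 - (norm z)\<^sup>2) / (norm v)\<^sup>2"
    unfolding * using False by (simp add: field_simps)
  also have "\<dots> = 2 * inner v z / (norm v)\<^sup>2"
    unfolding power2_norm_eq_inner
    by (simp add: inner_add_left inner_add_right inner_commute)
  finally have "inner 1 (inverse v * z) = inner v z / (norm v)\<^sup>2" by simp
  then show ?thesis using False by simp
qed simp

lemma helly_approximation:
  fixes sc :: "'k::{real_normed_field, euclidean_space} \<Rightarrow> 'x::real_normed_vector \<Rightarrow> 'x"
  assumes sc: "normed_space_over sc"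
    and \<Phi>: "\<Phi> \<in> bidual sc" and bound: "\<And>f. f \<in> dual sc \<Longrightarrow> norm (\<Phi> f) \<le> C * norm f"
    and C: "C > 0" and I: "finite I" "I \<subseteq> dual sc" and e: "e > 0"
  shows "\<exists>x. norm x \<le> C \<and> (\<forall>g\<in>I. norm (blinfun_apply g x - \<Phi> g) < e)"
  \<comment> \<open>Almost minimise the squared distance \<open>D\<close> over the ball. The variational inequality at an
      almost minimal point \<open>x\<close> yields a functional \<open>G\<close> separating \<open>\<Phi>\<close> from the ball, against
      \<open>norm (\<Phi> G) \<le> C * norm G\<close>; the quadratic structure of \<open>D\<close> replaces Hahn-Banach.\<close>
proof (rule ccontr)
  assume "\<not> ?thesis"
  then have far: "\<exists>g\<in>I. norm (blinfun_apply g x - \<Phi> g) \<ge> e" if "norm x \<le> C" for x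
    using that by (auto simp: not_less)
  define D where "D x = (\<Sum>g\<in>I. (norm (blinfun_apply g x - \<Phi> g))\<^sup>2)" for x
  define \<delta> where "\<delta> = Inf (D ` cball 0 C)"
  have De: "e\<^sup>2 \<le> D x" if x: "norm x \<le> C" for x
  proof -
    obtain g where g: "g \<in> I" "norm (blinfun_apply g x - \<Phi> g) \<ge> e" using far[OF x] by blast
    then have "e\<^sup>2 \<le> (norm (blinfun_apply g x - \<Phi> g))\<^sup>2" using e by (intro power_mono) auto
    also have "\<dots> \<le> D x" unfolding D_def using g I(1) by (intro member_le_sum) auto
    finally show ?thesis .
  qed
  have bdd: "bdd_below (D ` cball 0 C)" using De by (intro bdd_belowI[of _ "e\<^sup>2"]) auto
  have ne: "D ` cball 0 C \<noteq> {}" using C by auto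
  have "e\<^sup>2 \<le> \<delta>" unfolding \<delta>_def using De ne by (intro cInf_greatest) auto
  with e have \<delta>: "\<delta> > 0" by (meson less_le_trans zero_less_power)
  have D\<delta>: "\<delta> \<le> D x" if "norm x \<le> C" for x
    unfolding \<delta>_def using that bdd by (intro cInf_lower) auto
  \<comment> \<open>\<open>M\<close> dominates the quadratic term of \<open>D\<close> along any
    segment from \<open>x\<close> inside the ball; the added 1 permits division. The step size
    \<open>t\<close> makes \<open>t\<^sup>2 * M\<close> at most \<open>t * \<delta>\<close>. With
    the tolerance \<open>t * \<delta> / 2\<close> for \<open>x\<close>, the total error
    \<open>3 * t * \<delta> / 2\<close>, divided by \<open>2 * t\<close>, gives the constant
    \<open>3 * \<delta> / 4\<close> in \<open>approx\<close>.\<close>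
  define M where "M = (\<Sum>g\<in>I. (norm g * (2 * C))\<^sup>2) + 1"
  have M: "M > 0" unfolding M_def by (intro add_nonneg_pos sum_nonneg) auto
  define t where "t = min 1 (\<delta> / M)"
  have t: "0 < t" "t \<le> 1" "t * M \<le> \<delta>"
    using \<delta> M by (auto simp: t_def min_def field_simps split: if_splits)
  have "Inf (D ` cball 0 C) < \<delta> + t * \<delta> / 2" using t \<delta> by (simp add: \<delta>_def)
  from cInf_lessD[OF ne this] obtain x where x: "norm x \<le> C" "D x < \<delta> + t * \<delta> / 2"
    by auto
  define v where "v g = blinfun_apply g x - \<Phi> g" for g
  have approx: "(\<Sum>g\<in>I. inner (v g) (blinfun_apply g y - blinfun_apply g x)) > - (3 * \<delta> / 4)"
    if y: "norm y \<le> C" for y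
  proof -
    define w where "w (g :: 'x \<Rightarrow>\<^sub>L 'k) = blinfun_apply g y - blinfun_apply g x" for g
    \<comment> \<open>Moving a fraction \<open>t\<close> from \<open>x\<close> towards
      \<open>y\<close> stays in the ball by convexity, so \<open>D z\<close> cannot fall below the
      infimum.\<close>
    define z where "z = (1 - t) *\<^sub>R x + t *\<^sub>R y"
    have "norm z \<le> (1 - t) * norm x + t * norm y"
      unfolding z_def using t by (intro norm_triangle_le) auto
    also have "\<dots> \<le> (1 - t) * C + t * C"
      using t x y by (intro add_mono mult_left_mono) auto
    finally have "norm z \<le> C" by (simp add: algebra_simps)
    then have "\<delta> \<le> D z" by (rule D\<delta>)
    also have "D z = (\<Sum>g\<in>I. (norm (v g))\<^sup>2 + 2 * t * inner (v g) (w g) + t\<^sup>2 * (norm (w g))\<^sup>2)"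
      unfolding D_def
    proof (rule sum.cong)
      fix g :: "'x \<Rightarrow>\<^sub>L 'k"
      have "blinfun_apply g z = (1 - t) *\<^sub>R blinfun_apply g x + t *\<^sub>R blinfun_apply g y"
        by (simp only: z_def blinfun.add_right blinfun.scaleR_right)
      then have "blinfun_apply g z - \<Phi> g = v g + t *\<^sub>R w g"
        by (simp add: v_def w_def algebra_simps)
      then show "(norm (blinfun_apply g z - \<Phi> g))\<^sup>2 =
          (norm (v g))\<^sup>2 + 2 * t * inner (v g) (w g) + t\<^sup>2 * (norm (w g))\<^sup>2"
        unfolding power2_norm_eq_inner
        by (simp add: inner_add_left inner_add_right inner_commute power2_eq_square algebra_simps)
    qed simp
    also have "\<dots> = D x + 2 * t * (\<Sum>g\<in>I. inner (v g) (w g)) + t\<^sup>2 * (\<Sum>g\<in>I. (norm (w g))\<^sup>2)"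
      by (simp add: sum.distrib sum_distrib_left D_def v_def)
    finally have 1: "\<delta> \<le> D x + 2 * t * (\<Sum>g\<in>I. inner (v g) (w g)) + t\<^sup>2 * (\<Sum>g\<in>I. (norm (w g))\<^sup>2)" .
    have "(\<Sum>g\<in>I. (norm (w g))\<^sup>2) \<le> (\<Sum>g\<in>I. (norm g * (2 * C))\<^sup>2)"
    proof (intro sum_mono power_mono)
      fix g
      have "norm (w g) \<le> norm g * norm (y - x)"
        unfolding w_def using norm_blinfun[of g "y - x"] by (simp add: blinfun.diff_right)
      also have "\<dots> \<le> norm g * (2 * C)"
        using norm_triangle_ineq4[of y x] x y by (intro mult_left_mono) auto
      finally show "norm (w g) \<le> norm g * (2 * C)" .
    qed auto
    then have "t\<^sup>2 * (\<Sum>g\<in>I. (norm (w g))\<^sup>2) \<le> t\<^sup>2 * M"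
      by (intro mult_left_mono) (auto simp: M_def)
    also have "\<dots> \<le> t * \<delta>" using t by (simp add: power2_eq_square)
    finally have "0 < t * (2 * (\<Sum>g\<in>I. inner (v g) (w g)) + 3 * \<delta> / 2)"
      using 1 x(2) by (simp add: algebra_simps)
    then show ?thesis using t by (simp add: zero_less_mult_iff w_def)
  qed
  \<comment> \<open>These coefficients turn the real-linear maps \<open>- inner (v g)\<close> into
    real parts of scalar multiples, so that their sum is the real part of one functional
    \<open>G\<close> in the dual.\<close>
  define \<kappa> where "\<kappa> g = - ((norm (v g))\<^sup>2 *\<^sub>R inverse (v g))" for g
  have \<kappa>: "inner 1 (\<kappa> g * u) = - inner (v g) u" for g u
    using inner_eq_inner_one[of "v g" u] by (simp add: \<kappa>_def)
  define G where "G = (\<Sum>g\<in>I. scale_fun (\<kappa> g) g)"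
  have G: "G \<in> dual sc" unfolding G_def using I by (intro sum_scale_in_dual) auto
  have Gy: "inner 1 (blinfun_apply G y) = - (\<Sum>g\<in>I. inner (v g) (blinfun_apply g y))" for y
    by (simp add: G_def blinfun.sum_left inner_sum_right \<kappa> sum_negf)
  have "\<Phi> G = (\<Sum>g\<in>I. \<kappa> g * \<Phi> g)" unfolding G_def using \<Phi> I by (intro bidual_sum_scale) auto
  then have \<Phi>G: "inner 1 (\<Phi> G) = - (\<Sum>g\<in>I. inner (v g) (\<Phi> g))"
    by (simp add: inner_sum_right \<kappa> sum_negf)
  have Dx: "D x = (\<Sum>g\<in>I. inner (v g) (blinfun_apply g x)) - (\<Sum>g\<in>I. inner (v g) (\<Phi> g))"
    unfolding D_def v_def[symmetric] power2_norm_eq_inner sum_subtractf[symmetric]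
    by (intro sum.cong) (auto simp: v_def inner_diff_right)
  have re: "inner 1 (blinfun_apply G y) \<le> C * norm G - \<delta> / 4" if "norm y \<le> C" for y
  proof -
    \<comment> \<open>Since \<open>D x\<close> is at least \<open>\<delta>\<close>, the loss
      \<open>3 * \<delta> / 4\<close> still leaves a gap of \<open>\<delta> / 4\<close> between the
      ball and \<open>\<Phi>\<close>.\<close>
    have "inner 1 (blinfun_apply G y) < 3 * \<delta> / 4 - D x + inner 1 (\<Phi> G)"
      using approx[OF that] unfolding Gy \<Phi>G Dx by (simp add: inner_diff_right sum_subtractf)
    moreover have "inner 1 (\<Phi> G) \<le> C * norm G"
      using norm_cauchy_schwarz[of 1 "\<Phi> G"] bound[OF G] by simp
    ultimately show ?thesis using D\<delta>[OF x(1)] by simp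
  qed
  have b: "norm (blinfun_apply G y) \<le> C * norm G - \<delta> / 4" if y: "norm y \<le> C" for y
  proof (cases "blinfun_apply G y = 0")
    case True
    then show ?thesis using re[OF y] by simp
  next
    case False
    \<comment> \<open>Rotating \<open>y\<close> turns the bound on the real part into one on the norm.\<close>
    define c where "c = of_real (norm (blinfun_apply G y)) / blinfun_apply G y"
    have "norm (sc c y) \<le> C"
      using y False by (simp add: normed_space_over.norm_scale[OF sc] c_def norm_divide)
    from re[OF this] have "inner 1 (c * blinfun_apply G y) \<le> C * norm G - \<delta> / 4"
      using G by (simp add: dual_def)
    moreover have "c * blinfun_apply G y = norm (blinfun_apply G y) *\<^sub>R 1"
      using False by (simp add: c_def scaleR_conv_of_real)
    ultimately show ?thesis using norm_eq_1[of "1 :: 'k"] by simp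
  qed
  \<comment> \<open>Rescaling \<open>b\<close> from radius \<open>C\<close> to radius 1 bounds the
    operator norm of \<open>G\<close> strictly below itself. The case \<open>y = 0\<close> of
    \<open>b\<close> supplies nonnegativity of the bound.\<close>
  have "norm G \<le> norm G - \<delta> / (4 * C)"
  proof (rule norm_blinfun_bound)
    show "0 \<le> norm G - \<delta> / (4 * C)"
      using b[of 0] C by (simp add: blinfun.zero_right field_simps)
    fix y
    show "norm (blinfun_apply G y) \<le> (norm G - \<delta> / (4 * C)) * norm y"
    proof (cases "y = 0")
      case False
      then have "norm (blinfun_apply G ((C / norm y) *\<^sub>R y)) \<le> C * norm G - \<delta> / 4"
        using C by (intro b) auto
      then show ?thesis using C False by (simp add: blinfun.scaleR_right field_simps)
    qed (simp add: blinfun.zero_right)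
  qed
  with \<delta> C show False by (simp add: field_simps)
qed

section \<open>Weak* compactness of the bidual ball\<close>

text \<open>Banach-Alaoglu: the ball is cut out of a product of closed scalar balls, compact by
  Tychonoff, by the linearity equations, each of which equates two continuous maps and is therefore
  closed.\<close>

lemma compactin_weak_star_unit_ball:
  fixes sc :: "'k::{real_normed_field, euclidean_space} \<Rightarrow> 'x::real_normed_vector \<Rightarrow> 'x"
  shows "compactin (weak_star_topology_bidual sc)
    {\<Phi> \<in> bidual sc. \<forall>f\<in>dual sc. norm (\<Phi> f) \<le> norm f}"
proof -
  define P :: "(('x \<Rightarrow>\<^sub>L 'k) \<Rightarrow> 'k) topology" where "P = product_topology (\<lambda>_. euclidean) (dual sc)"
  define K where "K = (\<Pi>\<^sub>E f\<in>dual sc. cball (0 :: 'k) (norm f))"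
  let ?B = "{\<Phi> \<in> bidual sc. \<forall>f\<in>dual sc. norm (\<Phi> f) \<le> norm f}"
  have K: "compactin P K" unfolding P_def K_def by (auto simp: compactin_PiE)
  have proj: "continuous_map P euclidean (\<lambda>\<Phi>. \<Phi> f)" if "f \<in> dual sc" for f
    using continuous_map_product_projection[OF that, of "\<lambda>_. euclidean"] by (simp add: P_def)
  have top: "topspace P = extensional (dual sc)" by (auto simp: P_def PiE_def)
  define \<A> where "\<A> = (\<Inter>f\<in>dual sc. \<Inter>g\<in>dual sc. {\<Phi> \<in> topspace P. \<Phi> (f + g) = \<Phi> f + \<Phi> g})"
  define \<S> where "\<S> = (\<Inter>c. \<Inter>f\<in>dual sc. {\<Phi> \<in> topspace P. \<Phi> (scale_fun c f) = c * \<Phi> f})"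
  have ne: "dual sc \<noteq> {}" using zero_in_dual by blast
  have "closedin P {\<Phi> \<in> topspace P. \<Phi> (f + g) = \<Phi> f + \<Phi> g}"
    if "f \<in> dual sc" "g \<in> dual sc" for f g
    by (rule closedin_continuous_maps_eq[of euclidean, OF _ proj[OF add_in_dual[OF that]]
          continuous_map_add[OF proj[OF that(1)] proj[OF that(2)]]]) simp
  then have "closedin P \<A>" unfolding \<A>_def using ne by (intro closedin_INT)
  moreover have "closedin P {\<Phi> \<in> topspace P. \<Phi> (scale_fun c f) = c * \<Phi> f}"
    if f: "f \<in> dual sc" for c f
  proof (rule closedin_continuous_maps_eq[of euclidean])
    have "continuous_map P euclidean ((\<lambda>z. c * z) \<circ> (\<lambda>\<Phi>. \<Phi> f))"
      by (rule continuous_map_compose[OF proj[OF f]])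
        (simp add: continuous_on_mult_left continuous_on_id)
    then show "continuous_map P euclidean (\<lambda>\<Phi>. c * \<Phi> f)" by (simp add: o_def)
    show "continuous_map P euclidean (\<lambda>\<Phi>. \<Phi> (scale_fun c f))"
      by (rule proj[OF scale_fun_in_dual[OF f]])
  qed simp
  then have "closedin P \<S>" unfolding \<S>_def using ne by (intro closedin_INT) auto
  ultimately have "compactin P ((\<A> \<inter> \<S>) \<inter> K)"
    by (intro closed_Int_compactin closedin_Int K)
  moreover have "(\<A> \<inter> \<S>) \<inter> K = ?B"
  proof (intro equalityI subsetI)
    fix \<Phi> assume "\<Phi> \<in> ?B"
    then show "\<Phi> \<in> \<A> \<inter> \<S> \<inter> K"
      unfolding \<A>_def \<S>_def K_def top bidual_def PiE_def by simp
  next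
    fix \<Phi> assume \<Phi>: "\<Phi> \<in> \<A> \<inter> \<S> \<inter> K"
    then have le: "\<forall>f\<in>dual sc. norm (\<Phi> f) \<le> norm f" by (simp add: K_def PiE_def Pi_iff)
    then have "\<exists>C. \<forall>f\<in>dual sc. norm (\<Phi> f) \<le> C * norm f" by (intro exI[of _ 1]) simp
    with \<Phi> le show "\<Phi> \<in> ?B"
      unfolding \<A>_def \<S>_def K_def top bidual_def PiE_def by simp
  qed
  ultimately have "compactin (subtopology P ?B) ?B" by (simp add: compactin_subtopology)
  \<comment> \<open>Compactness passes to the weak* topology as the image under the identity, so
    only continuity in this direction is required.\<close>
  moreover have "continuous_map (subtopology P ?B) (weak_star_topology_bidual sc) (\<lambda>\<Phi>. \<Phi>)"
    unfolding weak_star_topology_bidual_def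
  proof (rule continuous_map_into_initial_topology)
    show "(\<lambda>\<Phi>. \<Phi>) \<in> topspace (subtopology P ?B) \<rightarrow> bidual sc" by simp
    fix \<phi> :: "(('x \<Rightarrow>\<^sub>L 'k) \<Rightarrow> 'k) \<Rightarrow> 'k" assume "\<phi> \<in> (\<lambda>f F. F f) ` dual sc"
    then obtain f where f: "\<phi> = (\<lambda>F. F f)" "f \<in> dual sc" by blast
    show "continuous_map (subtopology P ?B) euclidean (\<lambda>\<Phi>. \<phi> \<Phi>)"
      unfolding f(1) by (rule continuous_map_from_subtopology[OF proj[OF f(2)]])
  qed
  ultimately have "compactin (weak_star_topology_bidual sc) ((\<lambda>\<Phi>. \<Phi>) ` ?B)"
    by (rule image_compactin)
  then show ?thesis by (simp only: image_ident)
qed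

section \<open>Weak*-continuous functionals on the bidual\<close>

text \<open>Linear algebra: a functional vanishing on the common kernel of finitely many functionals
  is a combination of them. Here these are evaluations, so the combination is evaluation at one
  \<open>e\<close>. The induction varies \<open>\<phi>\<close>, which is corrected at each
  step.\<close>

lemma functional_eq_evaluation_of_kernel:
  assumes lin: "\<And>F G c. F \<in> bidual sc \<Longrightarrow> G \<in> bidual sc \<Longrightarrow>
      \<phi> (\<lambda>f\<in>dual sc. F f + c * G f) = \<phi> F + c * \<phi> G"
    and "finite I" "I \<subseteq> dual sc"
    and "\<And>F. F \<in> bidual sc \<Longrightarrow> (\<And>f. f \<in> I \<Longrightarrow> F f = 0) \<Longrightarrow> \<phi> F = 0"
  shows "\<exists>e\<in>dual sc. \<forall>F\<in>bidual sc. \<phi> F = F e"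
  using assms(2,3,1,4)
proof (induction I arbitrary: \<phi> rule: finite_induct)
  case empty
  have "F 0 = 0" if "F \<in> bidual sc" for F
    using bidual_sum_scale[OF that, of "{}"] by simp
  with empty show ?case by (intro bexI[of _ 0]) auto
next
  case (insert f0 I)
  show ?case
  proof (cases "\<forall>F\<in>bidual sc. (\<forall>f\<in>I. F f = 0) \<longrightarrow> F f0 = 0")
    \<comment> \<open>Evaluation at \<open>f0\<close> adds no condition to the common kernel of
      \<open>I\<close>, so \<open>\<phi>\<close> itself satisfies the induction hypothesis.\<close>
    case True
    then have "\<phi> F = 0" if "F \<in> bidual sc" "\<And>f. f \<in> I \<Longrightarrow> F f = 0" for F
      using that by (intro insert.prems(3)) auto
    with insert.prems(1,2) show ?thesis by (intro insert.IH) auto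
  next
    case False
    then obtain F0 where F0: "F0 \<in> bidual sc" "\<And>f. f \<in> I \<Longrightarrow> F0 f = 0" "F0 f0 \<noteq> 0" by blast
    have f0: "f0 \<in> dual sc" and I: "I \<subseteq> dual sc" using insert.prems by auto
    \<comment> \<open>With this \<open>k\<close>, the functional \<open>\<phi>\<close> minus
      \<open>k\<close> times evaluation at \<open>f0\<close> vanishes at \<open>F0\<close>.\<close>
    define k where "k = \<phi> F0 / F0 f0"
    have "\<exists>e\<in>dual sc. \<forall>F\<in>bidual sc. \<phi> F - k * F f0 = F e"
    proof (rule insert.IH[OF I])
      fix F G c assume "F \<in> bidual sc" "G \<in> bidual sc"
      with f0 show "\<phi> (\<lambda>f\<in>dual sc. F f + c * G f) - k * (\<lambda>f\<in>dual sc. F f + c * G f) f0 =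
          \<phi> F - k * F f0 + c * (\<phi> G - k * G f0)"
        by (simp add: insert.prems algebra_simps)
    next
      fix F assume F: "F \<in> bidual sc" "\<And>f. f \<in> I \<Longrightarrow> F f = 0"
      \<comment> \<open>Adding this multiple of \<open>F0\<close> makes \<open>F\<close> vanish at
        \<open>f0\<close> while it still vanishes on \<open>I\<close>.\<close>
      define c where "c = - (F f0 / F0 f0)"
      have "\<phi> (\<lambda>f\<in>dual sc. F f + c * F0 f) = 0"
        using F F0 I f0 by (intro insert.prems bidual_combination) (auto simp: c_def)
      then have "\<phi> F + c * \<phi> F0 = 0"
        unfolding insert.prems(2)[OF F(1) F0(1)] .
      then show "\<phi> F - k * F f0 = 0" by (simp add: c_def k_def mult.commute)
    qed
    then obtain e where e: "e \<in> dual sc" "\<And>F. F \<in> bidual sc \<Longrightarrow> \<phi> F - k * F f0 = F e" by blast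
    have "\<phi> F = F (e + scale_fun k f0)" if "F \<in> bidual sc" for F
    proof -
      have "F (e + scale_fun k f0) = F e + k * F f0"
        using that e(1) f0 scale_fun_in_dual[OF f0, of k] by (simp add: bidual_def)
      with e(2)[OF that] show ?thesis by (simp add: algebra_simps)
    qed
    then show ?thesis using e(1) f0 by (blast intro: add_in_dual scale_fun_in_dual)
  qed
qed

text \<open>Continuity at zero bounds \<open>\<phi>\<close> on a neighbourhood given by finitely
  many evaluations. Their common kernel is a subspace inside it, and a functional bounded on a
  subspace vanishes there.\<close>

lemma weak_star_continuous_eq_evaluation:
  fixes sc :: "'k::{real_normed_field, euclidean_space} \<Rightarrow> 'x::real_normed_vector \<Rightarrow> 'x"
  assumes lin: "\<And>F G c. F \<in> bidual sc \<Longrightarrow> G \<in> bidual sc \<Longrightarrow>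
      \<phi> (\<lambda>f\<in>dual sc. F f + c * G f) = \<phi> F + c * \<phi> G"
    and cont: "continuous_map (weak_star_topology_bidual sc) euclidean \<phi>"
  shows "\<exists>e\<in>dual sc. \<forall>F\<in>bidual sc. \<phi> F = F e"
proof -
  define N where "N = (\<lambda>f\<in>dual sc. 0 :: 'k)"
  have N: "N \<in> bidual sc" unfolding N_def by (rule zero_in_bidual)
  have "\<phi> (\<lambda>f\<in>dual sc. N f + 1 * N f) = \<phi> N + 1 * \<phi> N" by (rule lin[OF N N])
  moreover have "(\<lambda>f\<in>dual sc. N f + 1 * N f) = N" by (auto simp: N_def)
  ultimately have \<phi>N: "\<phi> N = 0" by simp
  have "openin (weak_star_topology_bidual sc)
      {F \<in> topspace (weak_star_topology_bidual sc). \<phi> F \<in> ball 0 1}"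
    by (rule openin_continuous_map_preimage[OF cont]) simp
  then have op: "openin (initial_topology (bidual sc) ((\<lambda>f F. F f) ` dual sc))
      {F \<in> bidual sc. norm (\<phi> F) < 1}"
    by (simp add: weak_star_topology_bidual_def)
  have "N \<in> {F \<in> bidual sc. norm (\<phi> F) < 1}" using N \<phi>N by simp
  from openin_initial_topologyD[OF op this] obtain \<Psi> e where
    \<Psi>: "finite \<Psi>" "\<Psi> \<subseteq> (\<lambda>f F. F f) ` dual sc" "e > 0"
      "{t \<in> bidual sc. \<forall>\<psi>\<in>\<Psi>. dist (\<psi> t) (\<psi> N) < e} \<subseteq> {F \<in> bidual sc. norm (\<phi> F) < 1}"
    by blast
  from finite_subset_image[OF \<Psi>(1,2)] obtain I where
    I: "I \<subseteq> dual sc" "finite I" "\<Psi> = (\<lambda>f F. F f) ` I" by blast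
  show ?thesis
  proof (rule functional_eq_evaluation_of_kernel[OF lin I(2,1)])
    fix F assume F: "F \<in> bidual sc" "\<And>f. f \<in> I \<Longrightarrow> F f = 0"
    have "norm (c * \<phi> F) < 1" for c
    proof -
      let ?G = "\<lambda>f\<in>dual sc. N f + c * F f"
      have "?G \<in> bidual sc" by (rule bidual_combination[OF N F(1)])
      moreover have "\<forall>\<psi>\<in>\<Psi>. dist (\<psi> ?G) (\<psi> N) < e" using F(2) I \<Psi>(3) by (auto simp: N_def)
      ultimately have "norm (\<phi> ?G) < 1" using \<Psi>(4) by blast
      then show ?thesis using lin[OF N F(1)] \<phi>N by simp
    qed
    \<comment> \<open>A nonzero \<open>\<phi> F\<close> would give the contradiction
      \<open>norm 1 < 1\<close>.\<close>
    from this[of "inverse (\<phi> F)"] show "\<phi> F = 0" by (cases "\<phi> F = 0") auto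
  qed
qed

section \<open>The criterion for bounded bilinear maps\<close>

context bounded_bilinear_over
begin

lemma adjoint_op_combination:
  assumes z': "z' \<in> dual scaleZ" and "F \<in> bidual scaleY" "G \<in> bidual scaleY"
  shows "adjoint_op (bilinear_adjoint m z') (\<lambda>f\<in>dual scaleY. F f + c * G f) =
    adjoint_op (bilinear_adjoint m z') F + scale_fun c (adjoint_op (bilinear_adjoint m z') G)"
  using assms bidual_combination[OF assms(2,3)]
  by (intro blinfun_eqI)
    (simp add: adjoint_op_bilinear_adjoint_apply blinfun.add_left bilinear_adjoint_in_dual)

text \<open>The bilinear setting covers both module cases: a left action has the algebra as its
  first factor, a right action as its second.\<close>

lemma relatively_weakly_compact_iff_adjoint_continuous:
  assumes z': "z' \<in> dual scaleZ"
  shows "relatively_compactin (weak_topology_dual scaleY) {bilinear_adjoint m z' x | x. norm x \<le> 1}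
    \<longleftrightarrow> continuous_map (weak_star_topology_bidual scaleY) (weak_topology_dual scaleX)
          (adjoint_op (bilinear_adjoint m z'))"
    (is "relatively_compactin ?W ?TB \<longleftrightarrow> continuous_map ?WS ?WX ?Ts")
proof
  let ?T = "bilinear_adjoint m z'"
  have T: "?T x \<in> dual scaleY" for x by (rule bilinear_adjoint_in_dual[OF z'])
  have Ts: "?Ts F \<in> dual scaleX" if "F \<in> bidual scaleY" for F
    by (rule adjoint_op_in_dual[OF z' that])
  have Ts_apply: "blinfun_apply (?Ts F) x = F (?T x)" if "F \<in> bidual scaleY" for F x
    by (rule adjoint_op_bilinear_adjoint_apply[OF z' that])
  have topW: "topspace ?W = dual scaleY" by (simp add: weak_topology_dual_def)
  have contW: "continuous_map ?W euclidean F" if "F \<in> bidual scaleY" for F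
    unfolding weak_topology_dual_def using that by (rule continuous_map_initial_topology)
  {
    assume "relatively_compactin ?W ?TB"
    then have comp: "compactin ?W (?W closure_of ?TB)" by (simp add: relatively_compactin_def)
    show "continuous_map ?WS ?WX ?Ts"
      unfolding weak_topology_dual_def
    proof (rule continuous_map_into_initial_topology)
      show "?Ts \<in> topspace ?WS \<rightarrow> dual scaleX" using Ts by (simp add: weak_star_topology_bidual_def)
      fix \<Phi> assume \<Phi>: "\<Phi> \<in> bidual scaleX"
      then obtain C0 where C0: "\<And>f. f \<in> dual scaleX \<Longrightarrow> norm (\<Phi> f) \<le> C0 * norm f"
        unfolding bidual_def by blast
      define C where "C = \<bar>C0\<bar> + 1"
      have C: "C > 0" by (simp add: C_def)
      have bound: "norm (\<Phi> f) \<le> C * norm f" if "f \<in> dual scaleX" for f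
        using C0[OF that] mult_right_mono[of C0 C "norm f"] by (force simp: C_def)
      \<comment> \<open>The set \<open>\<C> (F, d)\<close> holds the \<open>e\<close> that solve the
        desired equation for \<open>F\<close> up to \<open>d\<close>. The factor \<open>C\<close>
        compensates for Helly's points lying in the ball of radius \<open>C\<close>, while
        \<open>?TB\<close> comes from the unit ball.\<close>
      define \<C> where "\<C> = (\<lambda>(F, d). {e \<in> dual scaleY. of_real C * F e \<in> cball (\<Phi> (?Ts F)) d})"
      have "?W closure_of ?TB \<inter> \<Inter>(\<C> ` (bidual scaleY \<times> {0<..})) \<noteq> {}"
      proof (rule comp[unfolded compactin_fip, THEN conjunct2, rule_format], intro conjI ballI allI impI)
        fix U assume "U \<in> \<C> ` (bidual scaleY \<times> {0<..})"
        then obtain F d where U: "F \<in> bidual scaleY" "U = \<C> (F, d)" by blast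
        have "continuous_map ?W euclidean ((\<lambda>z. of_real C * z) \<circ> F)"
          by (rule continuous_map_compose[OF contW[OF U(1)]]) (auto intro!: continuous_intros)
        from closedin_continuous_map_preimage[OF this, of "cball (\<Phi> (?Ts F)) d"]
        show "closedin ?W U" by (simp add: U(2) \<C>_def topW)
      next
        fix \<F> assume "finite \<F> \<and> \<F> \<subseteq> \<C> ` (bidual scaleY \<times> {0<..})"
        then obtain J where J: "J \<subseteq> bidual scaleY \<times> {0<..}" "finite J" "\<F> = \<C> ` J"
          by (meson finite_subset_image)
        \<comment> \<open>One tolerance serves all of \<open>J\<close>; the inserted 1 covers empty
          \<open>J\<close>.\<close>
        define d where "d = Min (insert 1 (snd ` J))"
        have d: "d > 0" "\<And>p. p \<in> J \<Longrightarrow> d \<le> snd p" using J by (auto simp: d_def)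
        have "\<exists>x. norm x \<le> C \<and> (\<forall>g\<in>?Ts ` fst ` J. norm (blinfun_apply g x - \<Phi> g) < d)"
          using J Ts by (intro helly_approximation[OF X.normed_space_over_axioms \<Phi> bound C _ _ d(1)]) auto
        then obtain x where x: "norm x \<le> C"
          "\<And>F r. (F, r) \<in> J \<Longrightarrow> norm (blinfun_apply (?Ts F) x - \<Phi> (?Ts F)) < d" by force
        define x1 where "x1 = (1 / C) *\<^sub>R x"
        have x1: "norm x1 \<le> 1" "x = C *\<^sub>R x1" using x(1) C by (auto simp: x1_def)
        have "?T x1 \<in> \<C> (F, r)" if p: "(F, r) \<in> J" for F r
        proof -
          have F: "F \<in> bidual scaleY" using p J by auto
          have "blinfun_apply (?Ts F) x = of_real C * F (?T x1)"
            by (simp add: x1(2) blinfun.scaleR_right Ts_apply[OF F] scaleR_conv_of_real)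
          then show ?thesis using x(2)[OF p] d(2)[OF p] T
            by (simp add: \<C>_def dist_norm norm_minus_commute)
        qed
        then have "?T x1 \<in> \<Inter>\<F>" using J(3) by auto
        moreover have "?T x1 \<in> ?W closure_of ?TB"
          using closure_of_subset[of ?TB ?W] x1(1) T by (auto simp: topW)
        ultimately show "?W closure_of ?TB \<inter> \<Inter>\<F> \<noteq> {}" by blast
      qed
      then obtain e where e: "e \<in> \<Inter>(\<C> ` (bidual scaleY \<times> {0<..}))" by blast
      have eq: "\<Phi> (?Ts F) = of_real C * F e" and e_dual: "e \<in> dual scaleY"
        if "F \<in> bidual scaleY" for F
      proof -
        have *: "e \<in> \<C> (F, d)" if "d > 0" for d using e \<open>F \<in> bidual scaleY\<close> that by auto
        show "e \<in> dual scaleY" using *[of 1] by (simp add: \<C>_def)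
        have "dist (\<Phi> (?Ts F)) (of_real C * F e) \<le> 0 + d" if "d > 0" for d
          using *[OF that] by (simp add: \<C>_def)
        then have "dist (\<Phi> (?Ts F)) (of_real C * F e) \<le> 0" by (rule field_le_epsilon)
        then show "\<Phi> (?Ts F) = of_real C * F e" by simp
      qed
      \<comment> \<open>Membership is part of every \<open>\<C> (F, d)\<close>, so some
        \<open>F\<close> must be supplied; the zero functional always exists.\<close>
      have "e \<in> dual scaleY" by (rule e_dual[OF zero_in_bidual])
      then have "continuous_map ?WS euclidean (\<lambda>F. F e)"
        unfolding weak_star_topology_bidual_def by (intro continuous_map_initial_topology) auto
      then have "continuous_map ?WS euclidean ((\<lambda>z. of_real C * z) \<circ> (\<lambda>F. F e))"
        by (rule continuous_map_compose) (auto intro!: continuous_intros)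
      then show "continuous_map ?WS euclidean (\<lambda>F. \<Phi> (?Ts F))"
        by (rule continuous_map_eq) (simp add: weak_star_topology_bidual_def eq)
    qed
  }
  {
    assume cont: "continuous_map ?WS ?WX ?Ts"
    have "\<exists>e\<in>dual scaleY. \<forall>F\<in>bidual scaleY. \<Phi> (?Ts F) = F e" if \<Phi>: "\<Phi> \<in> bidual scaleX" for \<Phi>
    proof (rule weak_star_continuous_eq_evaluation)
      fix F G c assume FG: "F \<in> bidual scaleY" "G \<in> bidual scaleY"
      show "\<Phi> (?Ts (\<lambda>f\<in>dual scaleY. F f + c * G f)) = \<Phi> (?Ts F) + c * \<Phi> (?Ts G)"
        using \<Phi> Ts FG scale_fun_in_dual[OF Ts[OF FG(2)], of c]
        by (simp add: adjoint_op_combination[OF z' FG] bidual_def)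
    next
      have "continuous_map ?WX euclidean \<Phi>"
        unfolding weak_topology_dual_def using \<Phi> by (rule continuous_map_initial_topology)
      from continuous_map_compose[OF cont this]
      show "continuous_map ?WS euclidean (\<lambda>F. \<Phi> (?Ts F))" by (simp add: o_def)
    qed
    then obtain R where R: "\<And>\<Phi>. \<Phi> \<in> bidual scaleX \<Longrightarrow> R \<Phi> \<in> dual scaleY"
      "\<And>\<Phi> F. \<Phi> \<in> bidual scaleX \<Longrightarrow> F \<in> bidual scaleY \<Longrightarrow> \<Phi> (?Ts F) = F (R \<Phi>)"
      by metis
    let ?B = "{\<Phi> \<in> bidual scaleX. \<forall>f\<in>dual scaleX. norm (\<Phi> f) \<le> norm f}"
    have "continuous_map (weak_star_topology_bidual scaleX) ?W R"
      unfolding weak_topology_dual_def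
    proof (rule continuous_map_into_initial_topology)
      show "R \<in> topspace (weak_star_topology_bidual scaleX) \<rightarrow> dual scaleY"
        using R(1) by (simp add: weak_star_topology_bidual_def)
      fix F assume F: "F \<in> bidual scaleY"
      have "continuous_map (weak_star_topology_bidual scaleX) euclidean (\<lambda>\<Phi>. \<Phi> (?Ts F))"
        unfolding weak_star_topology_bidual_def using Ts[OF F]
        by (intro continuous_map_initial_topology) auto
      \<comment> \<open>By the defining property of \<open>R\<close>, the composite of
        \<open>F\<close> with \<open>R\<close> is evaluation at \<open>?Ts F\<close>.\<close>
      then show "continuous_map (weak_star_topology_bidual scaleX) euclidean (\<lambda>\<Phi>. F (R \<Phi>))"
        by (rule continuous_map_eq) (simp add: weak_star_topology_bidual_def R(2) F)
    qed
    then have comp: "compactin ?W (R ` ?B)" by (rule image_compactin[OF compactin_weak_star_unit_ball])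
    then have closed: "closedin ?W (R ` ?B)"
      by (rule compactin_imp_closedin[OF Hausdorff_weak_topology_dual])
    have "?TB \<subseteq> R ` ?B"
    proof clarify
      fix x :: 'x assume x: "norm x \<le> 1"
      let ?ev = "\<lambda>f\<in>dual scaleX. blinfun_apply f x"
      have "norm (blinfun_apply f x) \<le> norm f" for f :: "'x \<Rightarrow>\<^sub>L 'k"
        using norm_blinfun[of f x] mult_left_mono[OF x, of "norm f"] by simp
      then have ev: "?ev \<in> ?B" using evaluation_in_bidual[of x scaleX] by simp
      have "?T x = R ?ev"
      proof (rule blinfun_eqI)
        fix y
        \<comment> \<open>Testing against evaluation at \<open>y\<close> reads off values:
          \<open>?F (R ?ev)\<close> equals \<open>?ev (?Ts ?F)\<close>, which is
          \<open>?F (?T x)\<close>. Thus \<open>R\<close> extends \<open>?T\<close> along the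
          canonical embedding.\<close>
        let ?F = "\<lambda>f\<in>dual scaleY. blinfun_apply f y"
        have F: "?F \<in> bidual scaleY" by (rule evaluation_in_bidual)
        have "?ev (?Ts ?F) = ?F (R ?ev)" by (rule R(2)[OF evaluation_in_bidual F])
        then show "blinfun_apply (?T x) y = blinfun_apply (R ?ev) y"
          using Ts[OF F] Ts_apply[OF F, of x] T[of x] R(1)[OF evaluation_in_bidual] by simp
      qed
      with ev show "?T x \<in> R ` ?B" by blast
    qed
    then have "?W closure_of ?TB \<subseteq> R ` ?B" by (rule closure_of_minimal[OF _ closed])
    then have "compactin ?W (?W closure_of ?TB)"
      by (rule closed_compactin[OF comp]) simp
    then show "relatively_compactin ?W ?TB"
      using T by (auto simp: relatively_compactin_def topW)
  }
qed

end

section \<open>Left and right modules\<close>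

theorem mainTheorem5:
  fixes scaleA :: "'k::{real_normed_field, euclidean_space} \<Rightarrow> 'a::{real_normed_algebra, banach} \<Rightarrow> 'a"
  assumes "banach_algebra_over scaleA"
  shows
    "(\<forall>(scaleB :: 'k \<Rightarrow> 'b::banach \<Rightarrow> 'b) (\<pi>l :: 'a \<Rightarrow> 'b \<Rightarrow> 'b) (b' :: 'b \<Rightarrow>\<^sub>L 'k).
        left_banach_module scaleA scaleB \<pi>l \<and> b' \<in> dual scaleB \<longrightarrow>
        (b' \<in> wap_left scaleB \<pi>l \<longleftrightarrow>
          continuous_map (weak_star_topology_bidual scaleB) (weak_topology_dual scaleA)
            (adjoint_op (bilinear_adjoint \<pi>l b')))) \<and>
     (\<forall>(scaleB :: 'k \<Rightarrow> 'c::banach \<Rightarrow> 'c) (\<pi>r :: 'c \<Rightarrow> 'a \<Rightarrow> 'c) (b' :: 'c \<Rightarrow>\<^sub>L 'k).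
        right_banach_module scaleA scaleB \<pi>r \<and> b' \<in> dual scaleB \<longrightarrow>
        (b' \<in> wap_right scaleA scaleB \<pi>r \<longleftrightarrow>
          continuous_map (weak_star_topology_bidual scaleA) (weak_topology_dual scaleB)
            (adjoint_op (bilinear_adjoint \<pi>r b'))))"
proof (intro conjI allI impI)
  fix scaleB :: "'k \<Rightarrow> 'b \<Rightarrow> 'b" and \<pi>l :: "'a \<Rightarrow> 'b \<Rightarrow> 'b" and b' :: "'b \<Rightarrow>\<^sub>L 'k"
  assume *: "left_banach_module scaleA scaleB \<pi>l \<and> b' \<in> dual scaleB"
  then interpret left_banach_module scaleA scaleB \<pi>l by simp
  show "b' \<in> wap_left scaleB \<pi>l \<longleftrightarrow>
      continuous_map (weak_star_topology_bidual scaleB) (weak_topology_dual scaleA)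
        (adjoint_op (bilinear_adjoint \<pi>l b'))"
    using * relatively_weakly_compact_iff_adjoint_continuous[of b'] by (simp add: wap_left_def)
next
  fix scaleB :: "'k \<Rightarrow> 'c \<Rightarrow> 'c" and \<pi>r :: "'c \<Rightarrow> 'a \<Rightarrow> 'c" and b' :: "'c \<Rightarrow>\<^sub>L 'k"
  assume *: "right_banach_module scaleA scaleB \<pi>r \<and> b' \<in> dual scaleB"
  then interpret right_banach_module scaleA scaleB \<pi>r by simp
  show "b' \<in> wap_right scaleA scaleB \<pi>r \<longleftrightarrow>
      continuous_map (weak_star_topology_bidual scaleA) (weak_topology_dual scaleB)
        (adjoint_op (bilinear_adjoint \<pi>r b'))"
    using * relatively_weakly_compact_iff_adjoint_continuous[of b'] by (simp add: wap_right_def)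
qed

end
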